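(* Let $A,B,C,D\in\mathbb{C}^{n\times n}$ have core inverses, and let $M=\begin{pmatrix}A&B\\ C&D\end{pmatrix}\in\mathbb{C}^{2n\times 2n}$. If $AB=BD$, $DC=CA$, $B^*A=DB^*$, $B(CB)^{\pi}=0$, $C(BC)^{\pi}=0$, and $A^{\mathrm{core}}BD^{\mathrm{core}}C$ is nilpotent, then $M$ has a core inverse.
   Context: For a complex square matrix $X$, $X^*$ denotes its conjugate transpose. $X$ has a core inverse if there is a matrix $Y$ of the same size with $YX^2=X$, $XY^2=Y$, $(XY)^*=XY$; such $Y$ is unique and is denoted $X^{\mathrm{core}}$. $X^{\pi}:=I-XX^{D}$, where $X^{D}$ is the Drazin inverse of $X$ (which always exists for complex square matrices); if $X$ has a group inverse $X^{\#}$ (the unique $Y$ with $XYX=X$, $YXY=Y$, $XY=YX$), then $X^{D}=X^{\#}$ and $X^{\pi}=I-XX^{\#}$. *)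

theory Defs
  imports "Jordan_Normal_Form.Schur_Decomposition"
begin

(* All matrices are complex matrices of Jordan_Normal_Form, with their size given by
   carrier_mat; the conjugate transpose is the mat_adjoint of that entry. *)

definition is_core_inverse :: "complex mat \<Rightarrow> complex mat \<Rightarrow> bool" where
  "is_core_inverse X Y \<longleftrightarrow>
     square_mat X \<and> Y \<in> carrier_mat (dim_row X) (dim_row X) \<and>
     Y * (X * X) = X \<and> X * (Y * Y) = Y \<and> mat_adjoint (X * Y) = X * Y"

definition has_core_inverse :: "complex mat \<Rightarrow> bool" where
  "has_core_inverse X \<longleftrightarrow> (\<exists>Y. is_core_inverse X Y)"

definition core_inverse :: "complex mat \<Rightarrow> complex mat" where
  "core_inverse X = (THE Y. is_core_inverse X Y)"

definition is_drazin_inverse :: "complex mat \<Rightarrow> complex mat \<Rightarrow> bool" where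
  "is_drazin_inverse X Y \<longleftrightarrow>
     square_mat X \<and> Y \<in> carrier_mat (dim_row X) (dim_row X) \<and>
     X * Y = Y * X \<and> Y * X * Y = Y \<and> (\<exists>k. X ^\<^sub>m (k + 1) * Y = X ^\<^sub>m k)"

definition drazin_inverse :: "complex mat \<Rightarrow> complex mat" where
  "drazin_inverse X = (THE Y. is_drazin_inverse X Y)"

definition spectral_idempotent :: "complex mat \<Rightarrow> complex mat" where
  "spectral_idempotent X = 1\<^sub>m (dim_row X) - X * drazin_inverse X"

definition nilpotent_mat :: "complex mat \<Rightarrow> bool" where
  "nilpotent_mat X \<longleftrightarrow> square_mat X \<and> (\<exists>k. X ^\<^sub>m k = 0\<^sub>m (dim_row X) (dim_row X))"

(* The remaining lemmas show that both descriptions above determine at most one matrix,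
   so the definite descriptions pick the intended inverse whenever it exists. *)

lemma mat_adjoint_carrier:
  "A \<in> carrier_mat m n \<Longrightarrow> mat_adjoint A \<in> carrier_mat n m"
  by (auto simp: mat_adjoint_def)

lemma mat_adjoint_index:
  fixes A :: "complex mat"
  assumes "A \<in> carrier_mat m n" "i < n" "j < m"
  shows "mat_adjoint A $$ (i, j) = cnj (A $$ (j, i))"
  using assms by (auto simp: mat_adjoint_def mat_of_rows_index)

lemma mat_adjoint_mult:
  fixes A B :: "complex mat"
  assumes A: "A \<in> carrier_mat m n" and B: "B \<in> carrier_mat n p"
  shows "mat_adjoint (A * B) = mat_adjoint B * mat_adjoint A"
proof (rule eq_matI)
  note c = mat_adjoint_carrier[OF A] mat_adjoint_carrier[OF B]
    mat_adjoint_carrier[OF mult_carrier_mat[OF A B]]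
  fix i j assume "i < dim_row (mat_adjoint B * mat_adjoint A)"
    "j < dim_col (mat_adjoint B * mat_adjoint A)"
  then have ij: "i < p" "j < m" using c by auto
  have "mat_adjoint (A * B) $$ (i, j) = (\<Sum>k = 0..<n. cnj (A $$ (j, k)) * cnj (B $$ (k, i)))"
    using A B ij
    by (simp add: mat_adjoint_index[OF mult_carrier_mat[OF A B]] scalar_prod_def)
  also have "\<dots> = (mat_adjoint B * mat_adjoint A) $$ (i, j)"
    using A B c ij
    by (auto simp: scalar_prod_def mat_adjoint_index[OF A] mat_adjoint_index[OF B]
        mult.commute intro!: sum.cong)
  finally show "mat_adjoint (A * B) $$ (i, j) = (mat_adjoint B * mat_adjoint A) $$ (i, j)" .
qed (use A B in \<open>auto simp: mat_adjoint_def\<close>)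

lemma core_inverse_unique:
  assumes "is_core_inverse X Y" "is_core_inverse X Z"
  shows "Y = Z"
proof -
  define n where "n = dim_row X"
  have X: "X \<in> carrier_mat n n" and Y: "Y \<in> carrier_mat n n" and Z: "Z \<in> carrier_mat n n"
    using assms by (auto simp: is_core_inverse_def n_def square_mat.simps)
  note assoc = assoc_mult_mat[where ?n\<^sub>1.0 = n and ?n\<^sub>2.0 = n and ?n\<^sub>3.0 = n and ?n\<^sub>4.0 = n]
  have inner: "X * W * X = X" if "is_core_inverse X W" "W \<in> carrier_mat n n" for W
  proof -
    have 1: "W * (X * X) = X" and 2: "X * (W * W) = W"
      using that by (auto simp: is_core_inverse_def)
    have "X * W * X = X * W * (W * (X * X))" by (simp add: 1)
    also have "\<dots> = X * (W * W) * (X * X)" using X that(2) by (simp add: assoc)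
    finally show ?thesis by (simp add: 1 2)
  qed
  have "X * Y * (X * Z) = X * Y * X * Z" using X Y Z by (simp add: assoc)
  then have e1: "X * Y * (X * Z) = X * Z" using inner[OF assms(1) Y] by simp
  have "X * Z * (X * Y) = X * Z * X * Y" using X Y Z by (simp add: assoc)
  then have e2: "X * Z * (X * Y) = X * Y" using inner[OF assms(2) Z] by simp
  have "X * Z = mat_adjoint (X * Y * (X * Z))"
    using e1 assms by (simp add: is_core_inverse_def)
  also have "\<dots> = mat_adjoint (X * Z) * mat_adjoint (X * Y)"
    using X Y Z by (intro mat_adjoint_mult) auto
  also have "\<dots> = X * Y" using assms e2 by (simp add: is_core_inverse_def)
  finally have e: "X * Z = X * Y" .
  have Y1: "Y * (X * X) = X" "X * (Y * Y) = Y" and Z1: "X * (Z * Z) = Z"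
    using assms by (auto simp: is_core_inverse_def)
  have aux: "Y * (X * W) = W" if "W \<in> carrier_mat n n" "X * (W * W) = W" for W
  proof -
    have "Y * (X * W) = Y * (X * (X * (W * W)))" by (simp add: that(2))
    also have "\<dots> = Y * (X * X) * (W * W)" using X Y that(1) by (simp add: assoc)
    finally show ?thesis by (simp add: Y1(1) that(2))
  qed
  show "Y = Z" using aux[OF Y Y1(2)] aux[OF Z Z1] e by simp
qed

lemma core_inverse_eq: "is_core_inverse X Y \<Longrightarrow> core_inverse X = Y"
  unfolding core_inverse_def using core_inverse_unique by blast

lemma drazin_inverse_unique:
  assumes "is_drazin_inverse X Y" "is_drazin_inverse X Z"
  shows "Y = Z"
proof -
  define n where "n = dim_row X"
  have X: "X \<in> carrier_mat n n" and Y: "Y \<in> carrier_mat n n" and Z: "Z \<in> carrier_mat n n"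
    using assms by (auto simp: is_drazin_inverse_def n_def square_mat.simps)
  note assoc = assoc_mult_mat[where ?n\<^sub>1.0 = n and ?n\<^sub>2.0 = n and ?n\<^sub>3.0 = n and ?n\<^sub>4.0 = n]
  have pow: "V ^\<^sub>m k \<in> carrier_mat n n" if "V \<in> carrier_mat n n" for V :: "complex mat" and k
    using that by simp
  have comm: "V ^\<^sub>m k * W = W * V ^\<^sub>m k"
    if V: "V \<in> carrier_mat n n" and W: "W \<in> carrier_mat n n" and VW: "V * W = W * V"
    for V W :: "complex mat" and k
  proof (induction k)
    case (Suc k)
    have "V ^\<^sub>m Suc k * W = V ^\<^sub>m k * (V * W)" using V W pow[OF V, of k] by (simp add: assoc)
    also have "\<dots> = V ^\<^sub>m k * W * V" unfolding VW using V W pow[OF V, of k] by (simp add: assoc)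
    also have "\<dots> = W * V ^\<^sub>m Suc k" using V W pow[OF V, of k] by (simp add: Suc assoc)
    finally show ?case .
  qed (use V W in simp)
  have Y1: "X * Y = Y * X" "Y * X * Y = Y" and Z1: "X * Z = Z * X" "Z * X * Z = Z"
    using assms by (auto simp: is_drazin_inverse_def)
  obtain k where k: "X ^\<^sub>m (k + 1) * Y = X ^\<^sub>m k"
    using assms(1) by (auto simp: is_drazin_inverse_def)
  obtain m where m: "X ^\<^sub>m (m + 1) * Z = X ^\<^sub>m m"
    using assms(2) by (auto simp: is_drazin_inverse_def)
  have repY: "Y ^\<^sub>m (j + 1) * X ^\<^sub>m j = Y" for j
  proof (induction j)
    case (Suc j)
    note p = X Y pow[OF X, of j] pow[OF Y, of "j + 1"]
    have "Y ^\<^sub>m (Suc j + 1) * X ^\<^sub>m Suc j = Y ^\<^sub>m (j + 1) * Y * (X ^\<^sub>m j * X)" by simp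
    also have "\<dots> = Y ^\<^sub>m (j + 1) * (Y * X ^\<^sub>m j) * X"
      using p by (simp only: assoc mult_carrier_mat)
    also have "\<dots> = Y ^\<^sub>m (j + 1) * X ^\<^sub>m j * (Y * X)"
      unfolding comm[OF X Y Y1(1), symmetric] using p by (simp only: assoc mult_carrier_mat)
    also have "\<dots> = Y" unfolding Suc using X Y Y1 by (metis assoc)
    finally show ?case .
  qed (use Y X in simp)
  have repZ: "X ^\<^sub>m j * Z ^\<^sub>m (j + 1) = Z" for j
  proof (induction j)
    case (Suc j)
    note p = X Z pow[OF X, of j] pow[OF Z, of "j + 1"]
    have "X ^\<^sub>m Suc j * Z ^\<^sub>m (Suc j + 1) = X ^\<^sub>m j * X * (Z ^\<^sub>m (j + 1) * Z)" by simp
    also have "\<dots> = X ^\<^sub>m j * (X * Z ^\<^sub>m (j + 1)) * Z"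
      using p by (simp only: assoc mult_carrier_mat)
    also have "\<dots> = X ^\<^sub>m j * Z ^\<^sub>m (j + 1) * X * Z"
      unfolding comm[OF Z X Z1(1)[symmetric], symmetric] using p
      by (simp only: assoc mult_carrier_mat)
    also have "\<dots> = Z" unfolding Suc by (rule Z1(2))
    finally show ?case .
  qed (use Z X in simp)
  have "Y = Y ^\<^sub>m (m + 1) * (X ^\<^sub>m m * X * Z)" using repY[of m] m by simp
  also have "\<dots> = Y ^\<^sub>m (m + 1) * X ^\<^sub>m m * X * Z"
    using X Z pow[OF X, of m] pow[OF Y, of "m + 1"] by (simp only: assoc mult_carrier_mat)
  finally have Yeq: "Y = Y * X * Z" unfolding repY .
  have "Z = X ^\<^sub>m (k + 1) * Y * Z ^\<^sub>m (k + 1)" using repZ[of k] k by simp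
  also have "\<dots> = Y * X ^\<^sub>m (k + 1) * Z ^\<^sub>m (k + 1)" by (simp only: comm[OF X Y Y1(1)])
  also have "\<dots> = Y * (X * X ^\<^sub>m k) * Z ^\<^sub>m (k + 1)" using comm[OF X X refl, of k] by simp
  also have "\<dots> = Y * X * (X ^\<^sub>m k * Z ^\<^sub>m (k + 1))"
    using X Y pow[OF X, of k] pow[OF Z, of "k + 1"] by (simp only: assoc mult_carrier_mat)
  finally have Zeq: "Z = Y * X * Z" unfolding repZ .
  show "Y = Z" using Yeq Zeq by simp
qed

lemma drazin_inverse_eq: "is_drazin_inverse X Y \<Longrightarrow> drazin_inverse X = Y"
  unfolding drazin_inverse_def using drazin_inverse_unique by blast

end

(* Write M = P + Q with P = diag(A, D) and Q the block antidiagonal of B and C. A complex matrix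
   has a core inverse iff its index is at most 1. The relations AB = BD and DC = CA say that P and Q
   commute, and B(CB)^pi = 0, C(BC)^pi = 0 make Q of index at most 1. The relation on B* makes B
   intertwine the core inverses of D and A, so that the nilpotent matrix of the hypothesis is
   (A^core)^2 BC. Its nilpotency gives A (BC)^k = 0, hence PQ = QP = 0, and the sum of the group
   inverses of P and Q is then a group inverse of M. *)

theory Submission
  imports Defs
begin

section \<open>Powers of a matrix and existence of the Drazin inverse\<close>

text \<open>The powers with exponents 0, ..., \<open>n * n\<close> are \<open>n * n + 1\<close>
  elements of a space of dimension \<open>n * n\<close>. The dimension count takes the form of a
  vanishing determinant.\<close>

lemma mat_powers_dependent:
  fixes X :: "'a :: field mat"
  assumes X: "X \<in> carrier_mat n n"
  obtains v :: "nat \<Rightarrow> 'a" and N k where "k < N" "v k \<noteq> 0"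
    "\<And>i j. i < n \<Longrightarrow> j < n \<Longrightarrow> (\<Sum>l<N. v l * (X ^\<^sub>m l) $$ (i, j)) = 0"
proof -
  define N where "N = Suc (n * n)"
  (* Column l lists the entries of X^l; the last row is a dummy zero row making W square and singular. *)
  define W where "W = mat N N (\<lambda>(r, l). if r = n * n then 0 else (X ^\<^sub>m l) $$ (r div n, r mod n))"
  have W: "W \<in> carrier_mat N N" by (simp add: W_def)
  \<comment> \<open>The dummy row is zero, so the unit vector at its index lies in the kernel of the
    transpose. Hence \<open>W\<close> is singular, and a nonzero kernel vector supplies the
    coefficients.\<close>
  have "transpose_mat W *\<^sub>v unit_vec N (n * n) = 0\<^sub>v N"
    by (rule eq_vecI) (auto simp: W_def N_def scalar_prod_right_unit)
  moreover have "unit_vec N (n * n) \<noteq> (0\<^sub>v N :: 'a vec)"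
    by (rule unit_vec_nonzero) (simp add: N_def)
  ultimately have "det (transpose_mat W) = 0"
    using det_0_iff_vec_prod_zero_field[of "transpose_mat W" N] W
    by (metis transpose_carrier_mat unit_vec_carrier)
  then have "det W = 0" using det_transpose[OF W] by simp
  then obtain v where v: "v \<in> carrier_vec N" "v \<noteq> 0\<^sub>v N" "W *\<^sub>v v = 0\<^sub>v N"
    using det_0_iff_vec_prod_zero_field[OF W] by blast
  obtain k where k: "k < N" "v $ k \<noteq> 0" using v(1,2) by (metis carrier_vecD eq_vecI index_zero_vec)
  show thesis
  proof (rule that[of k N "\<lambda>l. v $ l", OF k])
    fix i j assume ij: "i < n" "j < n"
    \<comment> \<open>Row-major position of the entry \<open>(i, j)\<close>, inverse to the
      \<open>div\<close> and \<open>mod\<close> decoding in \<open>W\<close>.\<close>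
    define r where "r = i * n + j"
    have "Suc i * n \<le> n * n" using ij(1) by (intro mult_right_mono) auto
    then have r: "r < n * n" "r div n = i" "r mod n = j" using ij by (auto simp: r_def)
    have "(W *\<^sub>v v) $ r = (\<Sum>l<N. (X ^\<^sub>m l) $$ (i, j) * v $ l)"
      using r v(1) by (auto simp: W_def N_def scalar_prod_def lessThan_atLeast0 intro!: sum.cong)
    then show "(\<Sum>l<N. v $ l * (X ^\<^sub>m l) $$ (i, j)) = 0"
      using v(3) r by (simp add: N_def mult.commute)
  qed
qed

lemma pow_mat_Suc_left:
  fixes X :: "'a :: semiring_1 mat"
  assumes X: "X \<in> carrier_mat n n"
  shows "X ^\<^sub>m Suc k = X * X ^\<^sub>m k"
proof (induction k)
  case (Suc k)
  have "X ^\<^sub>m Suc (Suc k) = X * X ^\<^sub>m k * X" using Suc by simp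
  then show ?case using X by (simp add: assoc_mult_mat[of _ n n _ n _ n])
qed (use X in simp)

lemma pow_mat_add:
  fixes X :: "'a :: semiring_1 mat"
  assumes X: "X \<in> carrier_mat n n"
  shows "X ^\<^sub>m (k + l) = X ^\<^sub>m k * X ^\<^sub>m l"
proof (induction l)
  case (Suc l)
  have "X ^\<^sub>m (k + Suc l) = X ^\<^sub>m k * X ^\<^sub>m l * X" using Suc by simp
  then show ?case using X by (simp add: assoc_mult_mat[of _ n n _ n _ n])
qed (use X in simp)

lemma pow_mat_commute:
  fixes X :: "'a :: semiring_1 mat"
  assumes X: "X \<in> carrier_mat n n" and Y: "Y \<in> carrier_mat n n" and XY: "X * Y = Y * X"
  shows "X ^\<^sub>m k * Y = Y * X ^\<^sub>m k"
proof (induction k)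
  case (Suc k)
  note assoc = assoc_mult_mat[of _ n n _ n _ n] mult_carrier_mat[of _ n n _ n]
  have "X ^\<^sub>m Suc k * Y = X ^\<^sub>m k * Y * X" using X Y XY by (simp add: assoc)
  then show ?case using X Y by (simp add: assoc Suc)
qed (use X Y in simp)

text \<open>Solve a linear relation among the powers of \<open>X\<close> for the lowest power that
  occurs. The other terms share the factor X^(k+1), and the cofactor \<open>R\<close> is a
  polynomial in \<open>X\<close>, so it commutes with \<open>X\<close>.\<close>

lemma pow_strongly_regular_exists:
  fixes X :: "'a :: field mat"
  assumes X: "X \<in> carrier_mat n n"
  obtains R k where "R \<in> carrier_mat n n" "X * R = R * X" "X ^\<^sub>m k = X ^\<^sub>m Suc k * R"
proof -
  obtain v :: "nat \<Rightarrow> 'a" and N k0 where k0: "k0 < N" "v k0 \<noteq> 0" and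
    dep: "\<And>i j. i < n \<Longrightarrow> j < n \<Longrightarrow> (\<Sum>l<N. v l * (X ^\<^sub>m l) $$ (i, j)) = 0"
    using mat_powers_dependent[OF X] by metis
  define k where "k = (LEAST k. v k \<noteq> 0)"
  have k: "v k \<noteq> 0" "\<And>l. l < k \<Longrightarrow> v l = 0"
    using k0(2) LeastI[of "\<lambda>k. v k \<noteq> 0"] not_less_Least unfolding k_def by auto
  have "k < N" using k0 k(2) by (metis leI le_less_trans linorder_neqE_nat)
  define L where "L = N - Suc k"
  have N: "N = Suc k + L" using \<open>k < N\<close> by (simp add: L_def)
  \<comment> \<open>Division by \<open>- v k\<close> expresses X^k as the sum of d_m X^(k+1+m) over
    \<open>m < L\<close>, so \<open>R\<close> has to be the sum of d_m X^m.\<close>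
  define d where "d m = - v (Suc k + m) / v k" for m
  define R where "R = mat n n (\<lambda>(i, j). \<Sum>m<L. d m * (X ^\<^sub>m m) $$ (i, j))"
  have R: "R \<in> carrier_mat n n" by (simp add: R_def)
  have pow: "X ^\<^sub>m m \<in> carrier_mat n n" for m using X by simp
  have left: "(Z * R) $$ (i, j) = (\<Sum>m<L. d m * (Z * X ^\<^sub>m m) $$ (i, j))"
    if "Z \<in> carrier_mat n n" "i < n" "j < n" for Z i j
  proof -
    have "(Z * R) $$ (i, j) = (\<Sum>l<n. \<Sum>m<L. d m * (Z $$ (i, l) * (X ^\<^sub>m m) $$ (l, j)))"
      using that X by (auto simp: R_def scalar_prod_def lessThan_atLeast0 sum_distrib_left
        mult.left_commute intro!: sum.cong)
    also have "\<dots> = (\<Sum>m<L. d m * (Z * X ^\<^sub>m m) $$ (i, j))"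
      using that X by (subst sum.swap) (auto simp: scalar_prod_def lessThan_atLeast0
        sum_distrib_left intro!: sum.cong)
    finally show ?thesis .
  qed
  have right: "(R * X) $$ (i, j) = (\<Sum>m<L. d m * (X ^\<^sub>m m * X) $$ (i, j))"
    if "i < n" "j < n" for i j
  proof -
    have "(R * X) $$ (i, j) = (\<Sum>l<n. \<Sum>m<L. d m * ((X ^\<^sub>m m) $$ (i, l) * X $$ (l, j)))"
      using that X by (auto simp: R_def scalar_prod_def lessThan_atLeast0 sum_distrib_right
        mult.assoc intro!: sum.cong)
    also have "\<dots> = (\<Sum>m<L. d m * (X ^\<^sub>m m * X) $$ (i, j))"
      using that X by (subst sum.swap) (auto simp: scalar_prod_def lessThan_atLeast0
        sum_distrib_left intro!: sum.cong)
    finally show ?thesis .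
  qed
  have comm: "X * R = R * X"
  proof (rule eq_matI)
    fix i j assume "i < dim_row (R * X)" "j < dim_col (R * X)"
    then have ij: "i < n" "j < n" using R X by auto
    show "(X * R) $$ (i, j) = (R * X) $$ (i, j)"
      unfolding left[OF X ij] right[OF ij] pow_mat_Suc_left[OF X, symmetric] by simp
  qed (use X R in auto)
  have "X ^\<^sub>m k = X ^\<^sub>m Suc k * R"
  proof (rule eq_matI)
    fix i j assume "i < dim_row (X ^\<^sub>m Suc k * R)" "j < dim_col (X ^\<^sub>m Suc k * R)"
    then have ij: "i < n" "j < n" using R X by auto
    have "0 = (\<Sum>l<Suc k + L. v l * (X ^\<^sub>m l) $$ (i, j))" using dep[OF ij] N by simp
    also have "\<dots> = (\<Sum>l<Suc k. v l * (X ^\<^sub>m l) $$ (i, j))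
        + (\<Sum>m<L. v (Suc k + m) * (X ^\<^sub>m (Suc k + m)) $$ (i, j))"
      by (induction L) (simp_all add: add.assoc del: sum.lessThan_Suc pow_mat.simps
        add: sum.lessThan_Suc[of _ "Suc k + _"] sum.lessThan_Suc[of _ L for L])
    also have "(\<Sum>l<Suc k. v l * (X ^\<^sub>m l) $$ (i, j)) = v k * (X ^\<^sub>m k) $$ (i, j)"
      using k(2) by (simp add: sum.neutral)
    finally have "v k * (X ^\<^sub>m k) $$ (i, j)
        = - (\<Sum>m<L. v (Suc k + m) * (X ^\<^sub>m (Suc k + m)) $$ (i, j))"
      by (simp add: eq_neg_iff_add_eq_0)
    then have "(X ^\<^sub>m k) $$ (i, j)
        = - (\<Sum>m<L. v (Suc k + m) * (X ^\<^sub>m (Suc k + m)) $$ (i, j)) / v k"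
      using k(1) by (simp add: field_simps)
    also have "\<dots> = (\<Sum>m<L. d m * (X ^\<^sub>m (Suc k + m)) $$ (i, j))"
      by (simp add: d_def sum_divide_distrib sum_negf)
    also have "\<dots> = (X ^\<^sub>m Suc k * R) $$ (i, j)"
      unfolding left[OF pow ij] pow_mat_add[OF X] ..
    finally show "(X ^\<^sub>m k) $$ (i, j) = (X ^\<^sub>m Suc k * R) $$ (i, j)" .
  qed (use X R in auto)
  then show thesis using that R comm by blast
qed

text \<open>Iterating X^k = X^(k+1) R gives X^k = X^(k+m) R^m for all m. Since \<open>R\<close>
  commutes with \<open>X\<close>, the matrix X^k R^(k+1) is then the Drazin inverse.\<close>

lemma drazin_inverse_exists:
  assumes X: "X \<in> carrier_mat n n"
  shows "\<exists>Y. is_drazin_inverse X Y"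
proof -
  obtain R k where R: "R \<in> carrier_mat n n" and XR: "X * R = R * X"
    and k: "X ^\<^sub>m k = X ^\<^sub>m Suc k * R"
    using pow_strongly_regular_exists[OF X] by metis
  note assoc = assoc_mult_mat[of _ n n _ n _ n] mult_carrier_mat[of _ n n _ n]
  have pw: "X ^\<^sub>m m \<in> carrier_mat n n" "R ^\<^sub>m m \<in> carrier_mat n n" for m using X R by auto
  have RX: "R ^\<^sub>m m * X = X * R ^\<^sub>m m" for m by (rule pow_mat_commute[OF R X XR[symmetric]])
  have rep: "X ^\<^sub>m (k + m) * R ^\<^sub>m m = X ^\<^sub>m k" for m
  proof (induction m)
    case (Suc m)
    have "X ^\<^sub>m (k + Suc m) * R ^\<^sub>m Suc m = X ^\<^sub>m (k + m) * (X * R ^\<^sub>m m) * R"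
      using X R pw by (simp add: assoc)
    also have "\<dots> = X ^\<^sub>m (k + m) * R ^\<^sub>m m * X * R"
      unfolding RX[symmetric] using X R pw by (simp add: assoc)
    also have "\<dots> = X ^\<^sub>m k" unfolding Suc using k[symmetric] by simp
    finally show ?case .
  qed (use X R in simp)
  define Y where "Y = X ^\<^sub>m k * R ^\<^sub>m Suc k"
  have Y: "Y \<in> carrier_mat n n" unfolding Y_def by (rule mult_carrier_mat[OF pw])
  have XY: "X * Y = X ^\<^sub>m Suc k * R ^\<^sub>m Suc k"
    unfolding Y_def pow_mat_Suc_left[OF X] using X pw by (simp add: assoc del: pow_mat.simps)
  have "Y * X = X ^\<^sub>m k * (R ^\<^sub>m Suc k * X)"
    unfolding Y_def using X pw by (simp add: assoc del: pow_mat.simps)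
  also have "\<dots> = X ^\<^sub>m k * X * R ^\<^sub>m Suc k"
    unfolding RX using X pw by (simp add: assoc del: pow_mat.simps)
  finally have YX: "Y * X = X * Y" unfolding XY by simp
  have kY: "X ^\<^sub>m (k + 1) * Y = X ^\<^sub>m k"
  proof -
    have "X ^\<^sub>m (k + 1) * Y = X ^\<^sub>m (Suc k) * X ^\<^sub>m k * R ^\<^sub>m Suc k"
      unfolding Y_def using X pw by (simp add: assoc del: pow_mat.simps)
    also have "\<dots> = X ^\<^sub>m (k + Suc k) * R ^\<^sub>m Suc k"
      unfolding pow_mat_add[OF X, symmetric] by (simp only: add.commute)
    finally show ?thesis using rep[of "Suc k"] by simp
  qed
  \<comment> \<open>Once \<open>Y\<close> is moved to the right of X^(k+1), \<open>kY\<close>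
    contracts the two to X^k, and X^k R^(k+1) is \<open>Y\<close> again.\<close>
  have "Y * X * Y = Y * (X * Y)" using X Y by (simp add: assoc)
  also have "\<dots> = Y * X ^\<^sub>m Suc k * R ^\<^sub>m Suc k"
    unfolding XY using Y pw by (simp add: assoc del: pow_mat.simps)
  also have "Y * X ^\<^sub>m Suc k = X ^\<^sub>m Suc k * Y"
    by (rule pow_mat_commute[OF X Y YX[symmetric], symmetric])
  also have "\<dots> = X ^\<^sub>m k" using kY by simp
  finally have "Y * X * Y = Y" unfolding Y_def .
  then show ?thesis
    using X Y YX kY by (auto simp: is_drazin_inverse_def square_mat.simps)
qed

section \<open>Adjoints and orthogonal projections\<close>

lemma mat_adjoint_adjoint:
  fixes X :: "complex mat"
  assumes X: "X \<in> carrier_mat m n"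
  shows "mat_adjoint (mat_adjoint X) = X"
  by (rule eq_matI) (use X mat_adjoint_carrier[OF X] mat_adjoint_carrier[OF mat_adjoint_carrier[OF X]]
    in \<open>auto simp: mat_adjoint_index[OF mat_adjoint_carrier[OF X]] mat_adjoint_index[OF X]\<close>)

text \<open>The diagonal entry \<open>(j, j)\<close> of the product is the sum of the squared moduli
  in column \<open>j\<close> of \<open>X\<close>.\<close>

lemma adjoint_mult_self_eq_0:
  fixes X :: "complex mat"
  assumes X: "X \<in> carrier_mat m n" and 0: "mat_adjoint X * X = 0\<^sub>m n n"
  shows "X = 0\<^sub>m m n"
proof (rule eq_matI)
  fix i j assume "i < dim_row (0\<^sub>m m n :: complex mat)" "j < dim_col (0\<^sub>m m n :: complex mat)"
  then have ij: "i < m" "j < n" by auto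
  have "(mat_adjoint X * X) $$ (j, j) = (\<Sum>k<m. cnj (X $$ (k, j)) * X $$ (k, j))"
    using X mat_adjoint_carrier[OF X] ij
    by (auto simp: scalar_prod_def mat_adjoint_index[OF X] lessThan_atLeast0 intro!: sum.cong)
  also have "\<dots> = of_real (\<Sum>k<m. (cmod (X $$ (k, j)))\<^sup>2)"
    by (simp only: of_real_sum complex_norm_square mult.commute)
  finally have "complex_of_real (\<Sum>k<m. (cmod (X $$ (k, j)))\<^sup>2) = 0" using 0 ij by simp
  then have "(\<Sum>k<m. (cmod (X $$ (k, j)))\<^sup>2) = 0" by (simp only: of_real_eq_0_iff)
  then have "(cmod (X $$ (i, j)))\<^sup>2 = 0" using ij by (subst (asm) sum_nonneg_eq_0_iff) auto
  then show "X $$ (i, j) = 0\<^sub>m m n $$ (i, j)" using ij by simp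
qed (use X in auto)

text \<open>Multiplying the hypothesis on the left by the adjoint of \<open>V\<close> shows that the
  Gram matrix of \<open>X * V\<close> vanishes.\<close>

lemma adjoint_cancel_left:
  fixes X V :: "complex mat"
  assumes X: "X \<in> carrier_mat n n" and V: "V \<in> carrier_mat n n"
    and 0: "mat_adjoint X * (X * V) = 0\<^sub>m n n"
  shows "X * V = 0\<^sub>m n n"
proof (rule adjoint_mult_self_eq_0)
  note Xa = mat_adjoint_carrier[OF X] and Va = mat_adjoint_carrier[OF V]
  have "mat_adjoint (X * V) * (X * V) = mat_adjoint V * (mat_adjoint X * (X * V))"
    unfolding mat_adjoint_mult[OF X V] using X V Xa Va by (simp add: assoc_mult_mat[of _ n n _ n _ n])
  then show "mat_adjoint (X * V) * (X * V) = 0\<^sub>m n n" using 0 Va by simp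
qed (use X V in simp)

lemma mat_eq_of_minus_eq_0:
  fixes X Y :: "'a :: group_add mat"
  assumes X: "X \<in> carrier_mat m n" and Y: "Y \<in> carrier_mat m n" and 0: "X - Y = 0\<^sub>m m n"
  shows "X = Y"
proof (rule eq_matI)
  fix i j assume "i < dim_row Y" "j < dim_col Y"
  then have "X $$ (i, j) - Y $$ (i, j) = 0"
    using X Y arg_cong[OF 0, of "\<lambda>Z. Z $$ (i, j)"] by auto
  then show "X $$ (i, j) = Y $$ (i, j)" by simp
qed (use X Y in auto)

text \<open>A Hermitian matrix has index at most 1: H H V = 0 implies H V = 0 by cancelling an
  adjoint. So H^k = H^(k+1) R descends to H = H H R, which is H R H.\<close>

lemma hermitian_inner_inverse_exists:
  fixes H :: "complex mat"
  assumes H: "H \<in> carrier_mat n n" and herm: "mat_adjoint H = H"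
  obtains R where "R \<in> carrier_mat n n" "H * R * H = H"
proof -
  note assoc = assoc_mult_mat[of _ n n _ n _ n] mult_carrier_mat[of _ n n _ n]
  obtain R k where R: "R \<in> carrier_mat n n" and HR: "H * R = R * H"
    and k: "H ^\<^sub>m k = H ^\<^sub>m Suc k * R"
    using pow_strongly_regular_exists[OF H] by metis
  have pw: "H ^\<^sub>m m \<in> carrier_mat n n" for m using H by simp
  define Z where "Z = 1\<^sub>m n - H * R"
  have Z: "Z \<in> carrier_mat n n" using H R by (simp add: Z_def minus_carrier_mat)
  have "H ^\<^sub>m k * Z = H ^\<^sub>m k - H ^\<^sub>m k * (H * R)"
    unfolding Z_def using H R pw[of k] by (subst mult_minus_distrib_mat[of _ n n _ n]) auto
  also have "H ^\<^sub>m k * (H * R) = H ^\<^sub>m Suc k * R" using H R pw[of k] by (simp add: assoc)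
  also have "\<dots> = H ^\<^sub>m k" by (rule k[symmetric])
  finally have "H ^\<^sub>m k * Z = 0\<^sub>m n n" using pw[of k] by simp
  then have "H * Z = 0\<^sub>m n n"
  proof (induction k)
    case 0
    then show ?case using H Z by simp
  next
    case (Suc j)
    show ?case
    proof (cases j)
      case 0
      then show ?thesis using Suc.prems H Z by simp
    next
      \<comment> \<open>The premise H^(i+2) Z = 0 reads H (H (H^i Z)) = 0; the outer factor is its
        own adjoint and cancels.\<close>
      case (Suc i)
      have V: "H ^\<^sub>m i * Z \<in> carrier_mat n n" using pw[of i] Z by simp
      have "mat_adjoint H * (H * (H ^\<^sub>m i * Z)) = H * (H * H ^\<^sub>m i) * Z"
        using herm H Z pw[of i] by (simp add: assoc)
      also have "\<dots> = H ^\<^sub>m Suc j * Z" unfolding Suc pow_mat_Suc_left[OF H] ..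
      finally have "H * (H ^\<^sub>m i * Z) = 0\<^sub>m n n"
        using Suc.prems adjoint_cancel_left[OF H V] by simp
      then have "H ^\<^sub>m j * Z = 0\<^sub>m n n"
        unfolding Suc pow_mat_Suc_left[OF H] using H Z pw[of i] by (simp add: assoc)
      then show ?thesis by (rule Suc.IH)
    qed
  qed
  moreover have "H * Z = H - H * (H * R)"
    unfolding Z_def using H R by (subst mult_minus_distrib_mat[of _ n n _ n]) auto
  ultimately have "H = H * (H * R)" using H R by - (rule mat_eq_of_minus_eq_0[of _ n n], auto)
  moreover have "H * R * H = H * (R * H)" using H R by (simp add: assoc)
  ultimately have "H * R * H = H" unfolding HR[symmetric] by simp
  then show thesis using that R by blast
qed


(* L = R X* with R an inner inverse of X* X: then X = X R X* X, and likewise for R*, which makes X L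
   a self-adjoint idempotent. *)
lemma orthogonal_range_projection_exists:
  fixes X :: "complex mat"
  assumes X: "X \<in> carrier_mat n n"
  obtains L where "L \<in> carrier_mat n n" "X * L * X = X" "mat_adjoint (X * L) = X * L"
proof -
  note assoc = assoc_mult_mat[of _ n n _ n _ n] mult_carrier_mat[of _ n n _ n]
  let ?Xa = "mat_adjoint X"
  note Xa = mat_adjoint_carrier[OF X]
  have aa: "mat_adjoint ?Xa = X" by (rule mat_adjoint_adjoint[OF X])
  let ?H = "?Xa * X"
  have H: "?H \<in> carrier_mat n n" using X Xa by simp
  have herm: "mat_adjoint ?H = ?H" unfolding mat_adjoint_mult[OF Xa X] aa ..
  obtain R where R: "R \<in> carrier_mat n n" and HRH: "?H * R * ?H = ?H"
    using hermitian_inner_inverse_exists[OF H herm] .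
  note Ra = mat_adjoint_carrier[OF R]
  \<comment> \<open>The left factor \<open>?Xa\<close> of ?H (S ?H - I) = 0 cancels. The matrix
    \<open>S\<close> is kept general because both \<open>R\<close> and its adjoint are
    inserted.\<close>
  have inner: "X * S * ?H = X" if S: "S \<in> carrier_mat n n" and HSH: "?H * S * ?H = ?H" for S
  proof -
    define V where "V = S * ?H - 1\<^sub>m n"
    have V: "V \<in> carrier_mat n n" using S X Xa by (simp add: V_def minus_carrier_mat)
    have "?H * V = ?H * (S * ?H) - ?H"
      unfolding V_def using S H by (subst mult_minus_distrib_mat[of _ n n _ n]) auto
    then have "?Xa * (X * V) = 0\<^sub>m n n" using HSH H S X Xa V by (simp add: assoc)
    then have "X * V = 0\<^sub>m n n" by (rule adjoint_cancel_left[OF X V])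
    moreover have "X * V = X * (S * ?H) - X"
      unfolding V_def using S H X by (subst mult_minus_distrib_mat[of _ n n _ n]) auto
    ultimately have "X * (S * ?H) = X"
      using X S H by - (rule mat_eq_of_minus_eq_0[of _ n n], auto)
    then show ?thesis using X S H by (simp add: assoc)
  qed
  let ?Ra = "mat_adjoint R"
  \<comment> \<open>Taking adjoints in \<open>HRH\<close> shows that the adjoint of \<open>R\<close>
    is also an inner inverse of the Hermitian \<open>?H\<close>.\<close>
  have "mat_adjoint (?H * R * ?H) = ?H * (?Ra * ?H)"
    using H R by (simp only: mat_adjoint_mult[of "?H * R" n n ?H n] mat_adjoint_mult[of ?H n n R n]
      herm mult_carrier_mat[of ?H n n R n])
  then have HRaH: "?H * ?Ra * ?H = ?H" using HRH herm H Ra by (simp add: assoc)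
  define L where "L = R * ?Xa"
  have L: "L \<in> carrier_mat n n" using R Xa by (simp add: L_def)
  have XL: "X * L = X * R * ?Xa" using X R Xa by (simp add: L_def assoc)
  have adj: "mat_adjoint (X * L) = X * ?Ra * ?Xa"
    unfolding XL using X R Xa Ra aa by (simp add: mat_adjoint_mult[of _ n n _ n] assoc)
  have XLX: "X * L * X = X" using inner[OF R HRH] X R Xa unfolding XL by (simp add: assoc)
  have "mat_adjoint (X * L) * X = X"
    unfolding adj using inner[OF Ra HRaH] X Ra Xa by (simp add: assoc)
  \<comment> \<open>With P = X L, the equation P* X = X gives P* P = P, and P* P is
    self-adjoint.\<close>
  then have eq: "mat_adjoint (X * L) * (X * L) = X * L"
    using X L mat_adjoint_carrier[of "X * L" n n] by (simp flip: assoc(1))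
  have "mat_adjoint (mat_adjoint (X * L) * (X * L)) = mat_adjoint (X * L) * (X * L)"
    using X L by (subst mat_adjoint_mult[of _ n n _ n]) (auto simp: mat_adjoint_adjoint[of _ n n] mat_adjoint_carrier)
  then have "mat_adjoint (X * L) = X * L" unfolding eq .
  with L XLX show thesis using that by blast
qed

section \<open>Core inverses of matrices of index at most 1\<close>

text \<open>The hypotheses force \<open>U * X = X * U\<close>, which is the idempotent X^# X. The
  core inverse is then X^# X L, with \<open>L\<close> an inner inverse of \<open>X\<close> for which
  \<open>X * L\<close> is Hermitian.\<close>

lemma has_core_inverse_if_index_le_1:
  assumes X: "X \<in> carrier_mat n n" and U: "U \<in> carrier_mat n n"
    and XXU: "X * X * U = X" and UXX: "U * (X * X) = X"
  shows "has_core_inverse X"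
proof -
  note assoc = assoc_mult_mat[of _ n n _ n _ n] mult_carrier_mat[of _ n n _ n]
  obtain L where L: "L \<in> carrier_mat n n" and XLX: "X * L * X = X"
    and herm: "mat_adjoint (X * L) = X * L"
    using orthogonal_range_projection_exists[OF X] .
  define Y where "Y = U * (X * L)"
  have Y: "Y \<in> carrier_mat n n" using U X L by (simp add: Y_def)
  have "U * (X * X * U) = U * (X * X) * U" using X U by (simp add: assoc)
  then have UX: "U * X = X * U" unfolding XXU UXX .
  have Y': "Y = X * U * L" unfolding UX[symmetric] Y_def using X U L by (simp add: assoc)
  have "X * Y = X * X * U * L" unfolding Y' using X U L by (simp add: assoc)
  then have XY: "X * Y = X * L" unfolding XXU .
  have "Y * (X * X) = U * (X * L * X * X)" unfolding Y_def using X U L by (simp add: assoc)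
  then have YXX: "Y * (X * X) = X" unfolding XLX UXX .
  have "X * (Y * Y) = X * Y * Y" using X Y by (simp add: assoc)
  also have "\<dots> = X * L * X * (U * L)" unfolding XY unfolding Y' using X U L by (simp add: assoc)
  also have "\<dots> = Y" unfolding XLX Y' using X U L by (simp add: assoc)
  finally have XYY: "X * (Y * Y) = Y" .
  show ?thesis unfolding has_core_inverse_def is_core_inverse_def
    using X Y YXX XYY herm XY by (intro exI[of _ Y]) (auto simp: square_mat.simps)
qed

text \<open>The last two facts follow by writing the final factor as X = Y X X and Y = X Y Y
  respectively.\<close>

lemma is_core_inverseD:
  assumes "is_core_inverse X Y" and X: "X \<in> carrier_mat n n"
  shows "Y \<in> carrier_mat n n" "Y * (X * X) = X" "X * (Y * Y) = Y"
    "mat_adjoint (X * Y) = X * Y" "X * Y * X = X" "Y * X * Y = Y"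
proof -
  note assoc = assoc_mult_mat[of _ n n _ n _ n] mult_carrier_mat[of _ n n _ n]
  show Y: "Y \<in> carrier_mat n n" and YXX: "Y * (X * X) = X" and XYY: "X * (Y * Y) = Y"
    and "mat_adjoint (X * Y) = X * Y"
    using assms by (auto simp: is_core_inverse_def)
  have "X * Y * (Y * (X * X)) = X * (Y * Y) * (X * X)" using X Y by (simp add: assoc)
  then show "X * Y * X = X" unfolding YXX XYY .
  have "Y * X * (X * (Y * Y)) = Y * (X * X) * (Y * Y)" using X Y by (simp add: assoc)
  then show "Y * X * Y = Y" unfolding YXX XYY .
qed

section \<open>Consequences of the commutation and nilpotency conditions\<close>

text \<open>\<open>A * Y\<close> and \<open>D * Z\<close> are the orthogonal projectors onto the
  ranges of \<open>A\<close> and \<open>D\<close>. By \<open>AB\<close>, \<open>B\<close> maps the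
  range of \<open>D\<close> into that of \<open>A\<close>; by \<open>AaB\<close>, it does the same
  for the orthogonal complements, the kernels of the adjoints. So \<open>B\<close> intertwines the
  projectors, and then the core inverses.\<close>

lemma core_inverse_intertwine:
  assumes X: "A \<in> carrier_mat n n" "B \<in> carrier_mat n n" "D \<in> carrier_mat n n"
    and Y: "is_core_inverse A Y" and Z: "is_core_inverse D Z"
    and AB: "A * B = B * D" and AaB: "mat_adjoint A * B = B * mat_adjoint D"
  shows "Y * B = B * Z"
proof -
  note assoc = assoc_mult_mat[of _ n n _ n _ n] mult_carrier_mat[of _ n n _ n]
  note YD = is_core_inverseD[OF Y X(1)] and ZD = is_core_inverseD[OF Z X(3)]
  note c = X YD(1) ZD(1) X[THEN mat_adjoint_carrier] YD(1)[THEN mat_adjoint_carrier]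
    ZD(1)[THEN mat_adjoint_carrier]
  \<comment> \<open>The range of \<open>B * D = A * B\<close> lies in that of \<open>A\<close>, on
    which \<open>A * Y\<close> is the identity.\<close>
  have "A * Y * B * (D * Z) = A * Y * (B * D) * Z" using c by (simp add: assoc)
  also have "\<dots> = A * Y * A * B * Z" unfolding AB[symmetric] using c by (simp add: assoc)
  also have "\<dots> = B * D * Z" unfolding YD(5) AB ..
  finally have 1: "A * Y * B * (D * Z) = B * (D * Z)" using c by (simp add: assoc)
  have AY: "A * Y = mat_adjoint Y * mat_adjoint A"
    using YD(4) mat_adjoint_mult[OF X(1) YD(1)] by simp
  have "mat_adjoint (D * Z * D) = mat_adjoint D * (D * Z)"
    using c ZD(4) by (simp add: mat_adjoint_mult[of _ n n _ n])
  then have Da: "mat_adjoint D * (D * Z) = mat_adjoint D" unfolding ZD(5) by simp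
  \<comment> \<open>Self-adjointness of \<open>A * Y\<close> brings the adjoint of \<open>A\<close>
    next to \<open>B\<close>; \<open>AaB\<close> trades it for the adjoint of \<open>D\<close>,
    which absorbs \<open>D * Z\<close> on its right.\<close>
  have YaDa: "A * Y * B = mat_adjoint Y * B * mat_adjoint D"
  proof -
    have "A * Y * B = mat_adjoint Y * (mat_adjoint A * B)" unfolding AY using c by (simp add: assoc)
    then show ?thesis unfolding AaB using c by (simp add: assoc)
  qed
  have "A * Y * B * (D * Z) = mat_adjoint Y * B * (mat_adjoint D * (D * Z))"
    unfolding YaDa using c by (simp add: assoc)
  then have "A * Y * B * (D * Z) = A * Y * B" unfolding Da YaDa .
  with 1 have W: "A * Y * B = B * (D * Z)" by simp
  \<comment> \<open>After \<open>W\<close> is applied, Z = D Z Z supplies a second factor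
    \<open>D\<close>. Moving both through \<open>B\<close> produces \<open>A * A\<close>, and Y A A
    = A removes \<open>Y\<close>.\<close>
  have "Y * B = Y * A * Y * B" unfolding YD(6) ..
  also have "\<dots> = Y * (A * Y * B)" using c by (simp add: assoc)
  also have "\<dots> = Y * (B * D) * Z" unfolding W using c by (simp add: assoc)
  also have "\<dots> = Y * (A * B) * (D * (Z * Z))" unfolding AB ZD(3) ..
  also have "\<dots> = Y * A * (B * D) * (Z * Z)" using c by (simp add: assoc)
  also have "\<dots> = Y * (A * A) * B * (Z * Z)" unfolding AB[symmetric] using c by (simp add: assoc)
  also have "\<dots> = B * D * (Z * Z)" unfolding YD(2) AB ..
  also have "\<dots> = B * (D * (Z * Z))" using c by (simp add: assoc)
  finally show ?thesis unfolding ZD(3) .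
qed

text \<open>\<open>T\<close> commutes with \<open>A\<close> but not necessarily with
  \<open>Y\<close>, so (Y Y T)^k cannot simply be split. With N = Y Y T one has N A^3 = A T instead,
  and by induction N^m A^(2m+1) = A T^m.\<close>

lemma mult_pow_eq_0_if_core_pow_eq_0:
  assumes X: "A \<in> carrier_mat n n" "T \<in> carrier_mat n n" and Y: "is_core_inverse A Y"
    and AT: "A * T = T * A" and 0: "(Y * Y * T) ^\<^sub>m k = 0\<^sub>m n n"
  shows "A * T ^\<^sub>m k = 0\<^sub>m n n"
proof -
  note assoc = assoc_mult_mat[of _ n n _ n _ n] mult_carrier_mat[of _ n n _ n]
  note YD = is_core_inverseD[OF Y X(1)]
  define N where "N = Y * Y * T"
  have N: "N \<in> carrier_mat n n" using X YD(1) by (simp add: N_def)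
  note c = X N YD(1)
  have pw: "T ^\<^sub>m m \<in> carrier_mat n n" "N ^\<^sub>m m \<in> carrier_mat n n" "A ^\<^sub>m m \<in> carrier_mat n n" for m
    using c by auto
  have TAW: "T * (A * W) = A * (T * W)" if "W \<in> carrier_mat n n" for W
    using arg_cong[OF AT, of "\<lambda>V. V * W"] that c by (simp add: assoc)
  have "N * (A * (A * A)) = Y * (Y * (T * (A * (A * A))))" unfolding N_def using c by (simp add: assoc)
  also have "T * (A * (A * A)) = A * A * A * T" using c by (simp add: TAW AT[symmetric] assoc)
  also have "Y * (Y * (A * A * A * T)) = Y * (Y * (A * A) * A * T)" using c by (simp add: assoc)
  also have "\<dots> = Y * (A * (A * T))" unfolding YD(2) using c by (simp add: assoc)
  also have "\<dots> = Y * (A * A) * T" using c by (simp add: assoc)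
  finally have NAAA: "N * (A * (A * A)) = A * T" unfolding YD(2) .
  have "N ^\<^sub>m m * (A * A ^\<^sub>m (2 * m)) = A * T ^\<^sub>m m" for m
  proof (induction m)
    case (Suc m)
    have "A * A ^\<^sub>m (2 * Suc m) = A * (A ^\<^sub>m 2 * A ^\<^sub>m (2 * m))"
      using pow_mat_add[OF X(1), of 2 "2 * m"] by simp
    also have "\<dots> = A * (A * A) * A ^\<^sub>m (2 * m)"
      using c pw by (simp add: numeral_2_eq_2 assoc)
    finally have "N ^\<^sub>m Suc m * (A * A ^\<^sub>m (2 * Suc m))
        = N ^\<^sub>m m * (N * (A * (A * A)) * A ^\<^sub>m (2 * m))"
      using c pw[of m] pw[of "2 * m"] by (simp add: assoc)
    also have "\<dots> = N ^\<^sub>m m * (A * (T * A ^\<^sub>m (2 * m)))"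
      unfolding NAAA using c pw[of "2 * m"] by (simp add: assoc)
    also have "\<dots> = N ^\<^sub>m m * (A * A ^\<^sub>m (2 * m)) * T"
      unfolding pow_mat_commute[OF X AT, symmetric] using c pw[of m] pw[of "2 * m"]
      by (simp add: assoc)
    finally show ?case unfolding Suc using c pw[of m] by (simp add: assoc)
  qed (use c in simp)
  from this[of k] show ?thesis
    unfolding 0[folded N_def] using left_mult_zero_mat[of "A * A ^\<^sub>m (2 * k)" n n n] c pw by simp
qed

text \<open>Existence of a Drazin inverse \<open>E\<close> gives the definite description its value;
  the hypothesis then reads X = X T E.\<close>

lemma mult_spectral_idempotent_eq_0D:
  assumes X: "X \<in> carrier_mat n n" and T: "T \<in> carrier_mat n n"
    and 0: "X * spectral_idempotent T = 0\<^sub>m n n"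
  obtains E where "E \<in> carrier_mat n n" "T * E = E * T" "E * T * E = E" "X * (T * E) = X"
proof -
  obtain E where dr: "is_drazin_inverse T E" using drazin_inverse_exists[OF T] by blast
  have E: "E \<in> carrier_mat n n" using dr T by (simp add: is_drazin_inverse_def)
  have "X * spectral_idempotent T = X - X * (T * E)"
    unfolding spectral_idempotent_def drazin_inverse_eq[OF dr]
    using X T E by (subst mult_minus_distrib_mat[of _ n n _ n]) auto
  then have "X = X * (T * E)"
    using 0 X T E by - (rule mat_eq_of_minus_eq_0[of _ n n], auto)
  then show thesis using that[OF E] dr by (simp add: is_drazin_inverse_def)
qed

theorem theorem4p4:
  fixes A B C D :: "complex mat" and n :: nat
  assumes "A \<in> carrier_mat n n" and "B \<in> carrier_mat n n"
    and "C \<in> carrier_mat n n" and "D \<in> carrier_mat n n"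
    and "has_core_inverse A" and "has_core_inverse B"
    and "has_core_inverse C" and "has_core_inverse D"
    and "A * B = B * D" and "D * C = C * A"
    and "mat_adjoint B * A = D * mat_adjoint B"
    and "B * spectral_idempotent (C * B) = 0\<^sub>m n n"
    and "C * spectral_idempotent (B * C) = 0\<^sub>m n n"
    and "nilpotent_mat (core_inverse A * B * core_inverse D * C)"
  shows "has_core_inverse (four_block_mat A B C D)"
proof -
  note assoc = assoc_mult_mat[of _ n n _ n _ n] mult_carrier_mat[of _ n n _ n]
  note ABCD = assms(1-4) and AB = assms(9) and DC = assms(10)
  obtain Y where Y: "is_core_inverse A Y" using assms(5) by (auto simp: has_core_inverse_def)
  obtain Z where Z: "is_core_inverse D Z" using assms(8) by (auto simp: has_core_inverse_def)
  note YD = is_core_inverseD[OF Y ABCD(1)] and ZD = is_core_inverseD[OF Z ABCD(4)]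
  obtain E where E: "E \<in> carrier_mat n n" and CBE: "C * B * E = E * (C * B)"
    and ECBE: "E * (C * B) * E = E" and BE: "B * (C * B * E) = B"
    using mult_spectral_idempotent_eq_0D[OF _ _ assms(12)] ABCD by (metis mult_carrier_mat)
  obtain F where F: "F \<in> carrier_mat n n" and BCF: "B * C * F = F * (B * C)"
    and FBCF: "F * (B * C) * F = F" and CF: "C * (B * C * F) = C"
    using mult_spectral_idempotent_eq_0D[OF _ _ assms(13)] ABCD by (metis mult_carrier_mat)
  note c = ABCD YD(1) ZD(1) E F
  define T where "T = B * C"
  have T: "T \<in> carrier_mat n n" using c by (simp add: T_def)

  \<comment> \<open>Vanishing of the products of diagonal and off-diagonal blocks\<close>
  have "mat_adjoint (mat_adjoint B * A) = mat_adjoint A * B"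
    using c by (simp add: mat_adjoint_mult[of _ n n _ n] mat_adjoint_carrier mat_adjoint_adjoint[of _ n n])
  moreover have "mat_adjoint (D * mat_adjoint B) = B * mat_adjoint D"
    using c by (simp add: mat_adjoint_mult[of _ n n _ n] mat_adjoint_carrier mat_adjoint_adjoint[of _ n n])
  ultimately have AaB: "mat_adjoint A * B = B * mat_adjoint D" using assms(11) by simp
  have YB: "Y * B = B * Z"
    by (rule core_inverse_intertwine[OF ABCD(1,2,4) Y Z AB AaB])
  have "core_inverse A * B * core_inverse D * C = Y * (B * Z) * C"
    unfolding core_inverse_eq[OF Y] core_inverse_eq[OF Z] using c by (simp add: assoc)
  also have "\<dots> = Y * Y * T" unfolding YB[symmetric] T_def using c by (simp add: assoc)
  finally obtain k where k: "(Y * Y * T) ^\<^sub>m k = 0\<^sub>m n n"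
    using assms(14) YD(1) by (auto simp: nilpotent_mat_def)
  have "A * T = A * B * C" unfolding T_def using c by (simp add: assoc)
  also have "\<dots> = B * (D * C)" unfolding AB using c by (simp add: assoc)
  finally have ATTA: "A * T = T * A" unfolding DC T_def using c by (simp add: assoc)
  have ATk: "A * T ^\<^sub>m k = 0\<^sub>m n n"
    by (rule mult_pow_eq_0_if_core_pow_eq_0[OF ABCD(1) T Y ATTA k])

  \<comment> \<open>Iterating B = B C B E splits off any power of \<open>T\<close> on the left of
    \<open>B\<close>. With exponent \<open>k\<close>, \<open>ATk\<close> then annihilates
    \<open>A * B\<close>.\<close>
  have "\<exists>W\<in>carrier_mat n n. B = T ^\<^sub>m m * (B * W)" for m
  proof (induction m)
    case 0
    then show ?case using c T by (intro bexI[of _ "1\<^sub>m n"]) auto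
  next
    case (Suc m)
    then obtain W where W: "W \<in> carrier_mat n n" "B = T ^\<^sub>m m * (B * W)" by blast
    have "B = T ^\<^sub>m m * (B * (C * B * E) * W)" unfolding BE by (rule W(2))
    also have "\<dots> = T ^\<^sub>m Suc m * (B * (E * W))"
      using c W(1) T pow_carrier_mat[OF T, of m] by (simp add: T_def assoc)
    finally show ?case using E W(1) by (intro bexI[of _ "E * W"]) auto
  qed
  then obtain W where W: "W \<in> carrier_mat n n" "B = T ^\<^sub>m k * (B * W)" by blast
  have "A * B = A * T ^\<^sub>m k * (B * W)"
    by (subst W(2)) (use c W(1) pow_carrier_mat[OF T, of k] in \<open>simp add: assoc\<close>)
  then have AB0: "A * B = 0\<^sub>m n n" unfolding ATk using c W(1) by simp
  then have BD0: "B * D = 0\<^sub>m n n" using AB by simp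
  have "T * A = A * B * C" unfolding ATTA[symmetric] unfolding T_def using c by (simp add: assoc)
  then have TA0: "T * A = 0\<^sub>m n n" unfolding AB0 using c by simp
  \<comment> \<open>C = C F T moves the question to \<open>T * A\<close>, which equals A B C and so
    vanishes with \<open>A * B\<close>.\<close>
  have "C * A = C * (F * T) * A" using CF unfolding BCF T_def by simp
  also have "\<dots> = C * F * (T * A)" using c T by (simp add: assoc)
  finally have CA0: "C * A = 0\<^sub>m n n" unfolding TA0 using c by simp
  then have DC0: "D * C = 0\<^sub>m n n" using DC by simp

  \<comment> \<open>The group inverse of the block matrix\<close>
  have z: "P * (Q * R) = 0\<^sub>m n n" if "P * Q = 0\<^sub>m n n" "P \<in> carrier_mat n n" "Q \<in> carrier_mat n n"
    "R \<in> carrier_mat n n" for P Q R :: "complex mat"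
    using that by (simp flip: assoc(1))
  define Ag where "Ag = Y * Y * A"
  define Dg where "Dg = Z * Z * D"
  have g: "Ag \<in> carrier_mat n n" "Dg \<in> carrier_mat n n" using c by (auto simp: Ag_def Dg_def)
  note c = c g
  \<comment> \<open>For a core inverse \<open>V\<close> of \<open>X\<close>, the matrix
    \<open>V * V * X\<close> is the group inverse of \<open>X\<close>. The third equation exhibits
    \<open>X\<close> as a left factor, so any matrix that annihilates \<open>X\<close> from the left
    annihilates \<open>V * V * X\<close> too.\<close>
  have grp: "X * X * (V * V * X) = X" "V * V * X * (X * X) = X" "V * V * X = X * (V * V * V * X)"
    if V: "is_core_inverse X V" and X: "X \<in> carrier_mat n n" for X V
  proof -
    note VD = is_core_inverseD[OF V X]
    have "X * X * (V * V * X) = X * (X * (V * V)) * X" using X VD(1) by (simp add: assoc)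
    then show "X * X * (V * V * X) = X" unfolding VD(3) VD(5) .
    have "V * V * X * (X * X) = V * (V * (X * X) * X)" using X VD(1) by (simp add: assoc)
    then show "V * V * X * (X * X) = X" unfolding VD(2) VD(2) .
    have "X * (V * V * V * X) = X * (V * V) * V * X" using X VD(1) by (simp add: assoc)
    then show "V * V * X = X * (V * V * V * X)" unfolding VD(3) by simp
  qed
  note Agp = grp[OF Y ABCD(1), folded Ag_def] and Dgp = grp[OF Z ABCD(4), folded Dg_def]
  have CAg: "C * Ag = 0\<^sub>m n n" unfolding Agp(3) by (rule z[OF CA0]) (use c in auto)
  have BDg: "B * Dg = 0\<^sub>m n n" unfolding Dgp(3) by (rule z[OF BD0]) (use c in auto)
  have AgB: "Ag * B = 0\<^sub>m n n" unfolding Ag_def using AB0 c by (simp add: assoc)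
  have DgC: "Dg * C = 0\<^sub>m n n" unfolding Dg_def using DC0 c by (simp add: assoc)
  have ABE: "A * (B * E) = 0\<^sub>m n n" by (rule z[OF AB0]) (use c in auto)
  have DCF: "D * (C * F) = 0\<^sub>m n n" by (rule z[OF DC0]) (use c in auto)
  \<comment> \<open>Commutation puts \<open>B\<close>, respectively \<open>C\<close>, at the right
    end, so that \<open>E * D\<close> and \<open>F * A\<close> contain the vanishing products
    \<open>B * D\<close> and \<open>C * A\<close>.\<close>
  have E2: "E = E * E * C * B"
    using ECBE c CBE by (metis assoc)
  have F2: "F = F * F * B * C"
    using FBCF c BCF by (metis assoc)
  have ED: "E * D = 0\<^sub>m n n" by (subst E2) (use BD0 c in \<open>simp add: assoc\<close>)
  have FA: "F * A = 0\<^sub>m n n" by (subst F2) (use CA0 c in \<open>simp add: assoc\<close>)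
  have BCBE: "B * (C * (B * E)) = B" using BE c by (simp add: assoc)
  have CBCF: "C * (B * (C * F)) = C" using CF c by (simp add: assoc)
  have BECB: "B * (E * (C * B)) = B" using BE CBE by simp
  have CFBC: "C * (F * (B * C)) = C" using CF BCF by simp

  define M where "M = four_block_mat A B C D"
  (* The group inverse of M: Ag and Dg are the group inverses of A and D, and the off-diagonal blocks
     form the group inverse of Q. *)
  define U where "U = four_block_mat Ag (B * E) (C * F) Dg"
  have MU: "M \<in> carrier_mat (n + n) (n + n)" "U \<in> carrier_mat (n + n) (n + n)"
    using c by (auto simp: M_def U_def)
  \<comment> \<open>The off-diagonal blocks A B + B D and C A + D C vanish, which leaves P^2 +
    Q^2.\<close>
  have MM: "M * M = four_block_mat (A * A + B * C) (0\<^sub>m n n) (0\<^sub>m n n) (C * B + D * D)"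
    unfolding M_def using c
    by (subst mult_four_block_mat[of _ n n _ n _ n _ _ n _ n]) (auto simp: AB0 BD0 CA0 DC0)
  have "M * M * U = M"
    unfolding MM unfolding U_def M_def
    using c AB0 ABE DCF DC0 CAg BDg BCBE CBCF Agp(1) Dgp(1)
    by (subst mult_four_block_mat[of _ n n _ n _ n _ _ n _ n])
      (auto simp: add_mult_distrib_mat[of _ n n _ _ n] assoc)
  moreover have "U * (M * M) = M"
    unfolding MM unfolding U_def M_def
    using c AgB DgC ED FA BECB CFBC Agp(2) Dgp(2)
    by (subst mult_four_block_mat[of _ n n _ n _ n _ _ n _ n])
      (auto simp: mult_add_distrib_mat[of _ n n _ n] assoc z[OF AgB] z[OF DgC] z[OF ED] z[OF FA])
  ultimately show ?thesis
    using has_core_inverse_if_index_le_1[OF MU] by (simp add: M_def)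
qed

end
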